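(* Let $d$ be a positive integer and $\chi$ a primitive Dirichlet character of conductor $d$. Let $w_1,w_2,w_3$ be any positive integers, $y_1\in\mathbb{Z}_p$, and $n\ge0$ an integer. Then \begin{align*} &(w_{1}w_{2})^{n-1}\sum_{a=0}^{w_{1}d-1}\sum_{b=0}^{w_{2}d-1}\chi(ab)B_{n,\chi}\Big(w_{3}y_{1}+\frac{w_{3}}{w_{1}}a+\frac{w_{3}}{w_{2}}b\Big)\\ =&(w_{2}w_{3})^{n-1}\sum_{a=0}^{w_{2}d-1}\sum_{b=0}^{w_{3}d-1}\chi(ab)B_{n,\chi}\Big(w_{1}y_{1}+\frac{w_{1}}{w_{2}}a+\frac{w_{1}}{w_{3}}b\Big)\\ =&(w_{3}w_{1})^{n-1}\sum_{a=0}^{w_{3}d-1}\sum_{b=0}^{w_{1}d-1}\chi(ab)B_{n,\chi}\Big(w_{2}y_{1}+\frac{w_{2}}{w_{3}}a+\frac{w_{2}}{w_{1}}b\Big). \end{align*}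
   Context: $p$ is a fixed prime, $\mathbb{Z}_p$ the $p$-adic integers; algebraic numbers are viewed in $\mathbb{C}_p$ via a fixed embedding $\overline{\mathbb{Q}}\to\mathbb{C}_p$. The character $\chi$ is regarded as a function on integers (periodic mod $d$, with $\chi(a)=0$ when $\gcd(a,d)>1$; for $d=1$, $\chi\equiv 1$). The generalized Bernoulli polynomials are defined by $\frac{te^{xt}}{e^{dt}-1}\sum_{a=0}^{d-1}\chi(a)e^{at}=\sum_{n\ge0}B_{n,\chi}(x)\frac{t^n}{n!}$. *)

theory Defs
  imports Complex_Main "HOL-Computational_Algebra.Computational_Algebra"
    "HOL-Number_Theory.Cong"
begin

subsection \<open>The field of p-adic complex numbers\<close>

definition padic_abs :: "nat \<Rightarrow> rat \<Rightarrow> real" where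
  "padic_abs p q =
     (if q = 0 then 0
      else real p powi (int (multiplicity (int p) (snd (quotient_of q)))
                        - int (multiplicity (int p) (fst (quotient_of q)))))"

definition abs_tendsto :: "('k::field_char_0 \<Rightarrow> real) \<Rightarrow> (nat \<Rightarrow> 'k) \<Rightarrow> 'k \<Rightarrow> bool" where
  "abs_tendsto absv X l \<longleftrightarrow> (\<lambda>n. absv (X n - l)) \<longlonglongrightarrow> 0"

definition abs_Cauchy :: "('k::field_char_0 \<Rightarrow> real) \<Rightarrow> (nat \<Rightarrow> 'k) \<Rightarrow> bool" where
  "abs_Cauchy absv X \<longleftrightarrow> (\<forall>e>0. \<exists>N. \<forall>m\<ge>N. \<forall>n\<ge>N. absv (X m - X n) < e)"

text \<open>
  Inside a complete field whose absolute value extends the p-adic one on the rationals,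
  the completion of the rationals is their topological closure.
\<close>

definition Qp_of :: "('k::field_char_0 \<Rightarrow> real) \<Rightarrow> 'k set" where
  "Qp_of absv = {l. \<exists>X. (\<forall>n. X n \<in> \<rat>) \<and> abs_tendsto absv X l}"

definition Zp_of :: "('k::field_char_0 \<Rightarrow> real) \<Rightarrow> 'k set" where
  "Zp_of absv = {x \<in> Qp_of absv. absv x \<le> 1}"

definition Qp_algebraic_of :: "('k::field_char_0 \<Rightarrow> real) \<Rightarrow> 'k set" where
  "Qp_algebraic_of absv =
     {x. \<exists>f. f \<noteq> 0 \<and> (\<forall>i. poly.coeff f i \<in> Qp_of absv) \<and> poly f x = 0}"

text \<open>
  A field \<open>'k\<close> with absolute value \<open>absv\<close> is (a copy of) the p-adic complex numbers
  if it is a completion of an algebraic closure of the p-adic numbers. This determines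
  \<open>('k, absv)\<close> up to isometric isomorphism; no particular construction is chosen.
\<close>

locale padic_complex_numbers =
  fixes p :: nat and absv :: "'k::field_char_0 \<Rightarrow> real"
  assumes prime_p: "prime p"
    and absv_nonneg: "absv x \<ge> 0"
    and absv_eq_0_iff: "absv x = 0 \<longleftrightarrow> x = 0"
    and absv_mult: "absv (x * y) = absv x * absv y"
    and absv_ultrametric: "absv (x + y) \<le> max (absv x) (absv y)"
    and absv_of_rat: "absv (of_rat q) = padic_abs p q"
    and complete: "abs_Cauchy absv X \<Longrightarrow> \<exists>l. abs_tendsto absv X l"
    and Qp_algebraic_closed:
      "\<lbrakk>degree f > 0; \<forall>i. poly.coeff f i \<in> Qp_algebraic_of absv\<rbrakk>
         \<Longrightarrow> \<exists>z\<in>Qp_algebraic_of absv. poly f z = 0"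
    and Qp_algebraic_dense:
      "\<exists>X. (\<forall>n. X n \<in> Qp_algebraic_of absv) \<and> abs_tendsto absv X l"

text \<open>
  An embedding of the field of algebraic numbers, taken as a subfield of the complex
  numbers; the values of \<open>\<iota>\<close> at transcendental numbers are irrelevant.
\<close>

definition algebraic_embedding :: "(complex \<Rightarrow> 'k::field_char_0) \<Rightarrow> bool" where
  "algebraic_embedding \<iota> \<longleftrightarrow>
     inj_on \<iota> {x. algebraic x} \<and> \<iota> 1 = 1 \<and>
     (\<forall>x y. algebraic x \<longrightarrow> algebraic y \<longrightarrow>
        \<iota> (x + y) = \<iota> x + \<iota> y \<and> \<iota> (x * y) = \<iota> x * \<iota> y)"

subsection \<open>Dirichlet characters\<close>

definition dirichlet_character :: "nat \<Rightarrow> (int \<Rightarrow> complex) \<Rightarrow> bool" where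
  "dirichlet_character d \<chi> \<longleftrightarrow>
     d > 0 \<and>
     (\<forall>a b. \<chi> (a * b) = \<chi> a * \<chi> b) \<and>
     (\<forall>a. \<chi> (a + int d) = \<chi> a) \<and>
     (\<forall>a. \<chi> a \<noteq> 0 \<longleftrightarrow> coprime a (int d))"

definition dirichlet_conductor :: "nat \<Rightarrow> (int \<Rightarrow> complex) \<Rightarrow> nat" where
  "dirichlet_conductor d \<chi> =
     (LEAST e. e dvd d \<and>
        (\<exists>\<psi>. dirichlet_character e \<psi> \<and> (\<forall>a. coprime a (int d) \<longrightarrow> \<chi> a = \<psi> a)))"

definition primitive_dirichlet_character :: "nat \<Rightarrow> (int \<Rightarrow> complex) \<Rightarrow> bool" where
  "primitive_dirichlet_character d \<chi> \<longleftrightarrow>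
     dirichlet_character d \<chi> \<and> dirichlet_conductor d \<chi> = d"

subsection \<open>Generalized Bernoulli polynomials\<close>

text \<open>
  The denominator has order 1 at 0, and so the division of formal power series is exact:
  the factor \<open>fps_X\<close> in the numerator cancels.
\<close>

definition gen_bernoulli_fps :: "nat \<Rightarrow> (int \<Rightarrow> 'k::field_char_0) \<Rightarrow> 'k \<Rightarrow> 'k fps" where
  "gen_bernoulli_fps d \<chi> x =
     fps_X * fps_exp x * (\<Sum>a<d. fps_const (\<chi> (int a)) * fps_exp (of_nat a))
       / (fps_exp (of_nat d) - 1)"

definition gen_bernpoly :: "nat \<Rightarrow> (int \<Rightarrow> 'k::field_char_0) \<Rightarrow> nat \<Rightarrow> 'k \<Rightarrow> 'k" where
  "gen_bernpoly d \<chi> n x = fact n * fps_nth (gen_bernoulli_fps d \<chi> x) n"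

end

theory Submission
  imports Defs
begin

text \<open>
  Write \<open>F c = \<Sum>a<d. \<chi>(a) e^(c a t)\<close> and \<open>D c = e^(c d t) - 1\<close>. Substituting \<open>w\<^sub>1 w\<^sub>2 t\<close> for \<open>t\<close> in
  the generating function and summing the blocks of length \<open>d\<close> geometrically, the first expression
  is \<open>n!\<close> times the coefficient of \<open>t^n\<close> in
  \<open>t e^(w\<^sub>1 w\<^sub>2 w\<^sub>3 y t) F(w\<^sub>1 w\<^sub>2) F(w\<^sub>2 w\<^sub>3) F(w\<^sub>3 w\<^sub>1) D(w\<^sub>1 w\<^sub>2 w\<^sub>3)\<^sup>2 / (D(w\<^sub>1 w\<^sub>2) D(w\<^sub>2 w\<^sub>3) D(w\<^sub>3 w\<^sub>1))\<close>,
  which is symmetric in the \<open>w\<^sub>i\<close>. The values of \<open>\<chi>\<close> are algebraic, so that the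
  embedding preserves their products.
\<close>

lemma fps_exp_minus_one_nonzero:
  assumes "c \<noteq> (0 :: 'k::field_char_0)"
  shows "fps_exp c - 1 \<noteq> 0"
proof
  assume "fps_exp c - 1 = 0"
  then have "fps_nth (fps_exp c - 1) 1 = 0" by simp
  then show False using assms by simp
qed

text \<open>Power series division inverts multiplication only when the divisor divides. Here the
  divisor has subdegree exactly 1, and the factor \<open>fps_X\<close> gives any nonzero numerator
  subdegree at least 1.\<close>

lemma gen_bernoulli_fps_mult:
  fixes x :: "'k::field_char_0"
  assumes "d > 0"
  shows "gen_bernoulli_fps d \<chi> x * (fps_exp (of_nat d) - 1) =
    fps_X * fps_exp x * (\<Sum>a<d. fps_const (\<chi> (int a)) * fps_exp (of_nat a))"
proof -
  let ?S = "\<Sum>a<d. fps_const (\<chi> (int a)) * fps_exp (of_nat a) :: 'k fps"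
  let ?D = "fps_exp (of_nat d :: 'k) - 1"
  have "subdegree ?D = 1"
    by (rule subdegreeI) (use assms in auto)
  moreover have "?D \<noteq> 0"
    using assms fps_exp_minus_one_nonzero[of "of_nat d :: 'k"] by simp
  moreover have "subdegree (fps_X * (fps_exp x * ?S)) \<ge> 1"
    if "fps_X * (fps_exp x * ?S) \<noteq> 0"
    by (rule subdegree_geI) (use that in auto)
  ultimately have "?D dvd fps_X * (fps_exp x * ?S)"
    by (cases "fps_X * (fps_exp x * ?S) = 0") (auto simp: fps_dvd_iff)
  then show ?thesis
    unfolding gen_bernoulli_fps_def by (simp add: mult.assoc)
qed

text \<open>For \<open>N = d\<close> this is the \<open>F c\<close> of the overview. The length
  stays free because the sums over \<open>a\<close> and \<open>b\<close> run up to multiples of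
  \<open>d\<close>.\<close>

definition char_exp_sum :: "nat \<Rightarrow> (int \<Rightarrow> 'k::field_char_0) \<Rightarrow> nat \<Rightarrow> 'k fps" where
  "char_exp_sum N \<chi> c = (\<Sum>a<N. fps_const (\<chi> (int a)) * fps_exp (of_nat (c * a)))"

text \<open>Geometric summation over blocks of length \<open>d\<close>, cross-multiplied because the
  \<open>D c\<close> have no constant term and so no inverse.\<close>

lemma char_exp_sum_periodic:
  fixes \<chi> :: "int \<Rightarrow> 'k::field_char_0"
  assumes per: "\<And>a. \<chi> (a + int d) = \<chi> a"
  shows "char_exp_sum (w * d) \<chi> c * (fps_exp (of_nat (c * d)) - 1) =
    char_exp_sum d \<chi> c * (fps_exp (of_nat (c * w * d)) - 1)"
proof (induction w)
  case 0
  then show ?case by (simp add: char_exp_sum_def)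
next
  case (Suc w)
  have shift: "\<chi> (int (w * d + a)) = \<chi> (int a)" for a
  proof (induction w)
    case (Suc w)
    have "\<chi> (int (Suc w * d + a)) = \<chi> (int (w * d + a) + int d)"
      by (simp add: algebra_simps)
    then show ?case using per Suc by simp
  qed simp
  have split: "sum f {..<m + k} = sum f {..<m} + (\<Sum>i<k. f (m + i))"
    for f :: "nat \<Rightarrow> 'k fps" and m k
    by (induction k) (auto simp: add.assoc)
  have block: "fps_const (\<chi> (int (w * d + a))) * fps_exp (of_nat (c * (w * d + a))) =
      fps_exp (of_nat (c * w * d)) * (fps_const (\<chi> (int a)) * fps_exp (of_nat (c * a)))" for a
    unfolding shift by (simp add: fps_exp_add_mult algebra_simps)
  have "char_exp_sum (Suc w * d) \<chi> c =
      char_exp_sum (w * d) \<chi> c + fps_exp (of_nat (c * w * d)) * char_exp_sum d \<chi> c"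
    unfolding char_exp_sum_def mult_Suc add.commute[of d] split block sum_distrib_left ..
  moreover have "fps_exp (of_nat (c * Suc w * d) :: 'k) =
      fps_exp (of_nat (c * w * d)) * fps_exp (of_nat (c * d))"
    by (simp add: fps_exp_add_mult[symmetric] algebra_simps)
  \<comment> \<open>With E = e^(cwdt) and G = e^(cdt), the step is (E - 1) + E(G - 1) = EG -
    1.\<close>
  ultimately show ?case
    using Suc by (simp only: ring_distribs) (simp add: algebra_simps)
qed

text \<open>Substituting ct for t respects sums and products and turns e^(at) into e^(cat); the
  factor t of the generating function becomes ct.\<close>

lemma gen_bernoulli_fps_scale:
  fixes x :: "'k::field_char_0"
  assumes "d > 0"
  shows "(gen_bernoulli_fps d \<chi> x oo (fps_const (of_nat c) * fps_X)) *
      (fps_exp (of_nat (c * d)) - 1) =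
    fps_const (of_nat c) * fps_X * fps_exp (of_nat c * x) * char_exp_sum d \<chi> c"
  using arg_cong[OF gen_bernoulli_fps_mult[OF assms, of \<chi> x],
      of "\<lambda>f. f oo (fps_const (of_nat c) * fps_X)"]
  by (simp add: fps_compose_mult_distrib fps_compose_sub_distrib fps_compose_sum_distrib
      fps_exp_compose_linear char_exp_sum_def)

text \<open>The exponential generating function, in \<open>n\<close>, of one of the three
  expressions. The substitution supplies (uv)^n and the leading inverse lowers the exponent to n -
  1.\<close>

definition bernoulli_sum_fps ::
    "nat \<Rightarrow> (int \<Rightarrow> 'k::field_char_0) \<Rightarrow> 'k \<Rightarrow> nat \<Rightarrow> nat \<Rightarrow> nat \<Rightarrow> 'k fps" where
  "bernoulli_sum_fps d \<chi> y u v w =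
     fps_const (inverse (of_nat (u * v))) *
       (\<Sum>a<u * d. \<Sum>b<v * d. fps_const (\<chi> (int a) * \<chi> (int b)) *
         (gen_bernoulli_fps d \<chi>
            (of_nat w * y + of_nat w / of_nat u * of_nat a + of_nat w / of_nat v * of_nat b)
           oo (fps_const (of_nat (u * v)) * fps_X)))"

lemma bernoulli_sum_fps_nth:
  fixes y :: "'k::field_char_0"
  assumes "u > 0" "v > 0"
  shows "fact n * fps_nth (bernoulli_sum_fps d \<chi> y u v w) n =
    of_nat (u * v) powi (int n - 1) *
      (\<Sum>a<u * d. \<Sum>b<v * d. \<chi> (int a) * \<chi> (int b) *
        gen_bernpoly d \<chi> n
          (of_nat w * y + of_nat w / of_nat u * of_nat a + of_nat w / of_nat v * of_nat b))"
proof -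
  have "(of_nat (u * v) :: 'k) powi (int n - 1) = inverse (of_nat (u * v)) * of_nat (u * v) ^ n"
    using assms by (simp add: power_int_diff divide_inverse mult.commute)
  then show ?thesis
    unfolding bernoulli_sum_fps_def gen_bernpoly_def
    by (simp del: of_nat_mult add: fps_sum_nth fps_compose_linear sum_distrib_left mult.assoc)
      (simp only: mult_ac)
qed

text \<open>The closed form of the overview with its denominators cleared. \<open>D (u * v)\<close>
  removes the Bernoulli denominator; the other two factors sum the blocks in \<open>a\<close> and in
  \<open>b\<close>.\<close>

lemma bernoulli_sum_fps_mult:
  fixes y :: "'k::field_char_0"
  assumes "d > 0" "u > 0" "v > 0"
    and per: "\<And>a. \<chi> (a + int d) = \<chi> a"
  defines "F \<equiv> char_exp_sum d \<chi>"
    and "D \<equiv> \<lambda>c. fps_exp (of_nat (c * d) :: 'k) - 1"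
  shows "bernoulli_sum_fps d \<chi> y u v w * (D (u * v) * D (v * w) * D (w * u)) =
    fps_X * fps_exp (of_nat (u * v * w) * y) * F (u * v) * F (v * w) * F (w * u) *
      (D (u * v * w))\<^sup>2"
proof -
  let ?c = "of_nat (u * v) :: 'k"
  let ?x = "\<lambda>a b. of_nat w * y + of_nat w / of_nat u * of_nat a + of_nat w / of_nat v * of_nat b"
  let ?K = "fps_X * fps_exp (of_nat (u * v * w) * y) * F (u * v)"
  have c: "fps_const (inverse ?c) * fps_const ?c = 1"
    using assms by (simp del: of_nat_mult)
  \<comment> \<open>Scaling by uv clears the fractions, so the exponential splits into separate
    factors for \<open>y\<close>, \<open>a\<close> and \<open>b\<close>, and the double sum becomes
    a product.\<close>
  have arg: "?c * ?x a b = of_nat (u * v * w) * y + of_nat (v * w * a) + of_nat (w * u * b)" for a b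
    using assms by (simp add: field_simps)
  have summand: "fps_const (inverse ?c) * (fps_const (\<chi> (int a) * \<chi> (int b)) *
        ((gen_bernoulli_fps d \<chi> (?x a b) oo (fps_const ?c * fps_X)) * D (u * v))) =
      ?K * ((fps_const (\<chi> (int a)) * fps_exp (of_nat (v * w * a))) *
        (fps_const (\<chi> (int b)) * fps_exp (of_nat (w * u * b))))" for a b
  proof -
    have "fps_const (inverse ?c) * (fps_const (\<chi> (int a) * \<chi> (int b)) *
        ((gen_bernoulli_fps d \<chi> (?x a b) oo (fps_const ?c * fps_X)) * D (u * v))) =
      (fps_const (inverse ?c) * fps_const ?c) * (fps_const (\<chi> (int a)) * fps_const (\<chi> (int b)) *
        (fps_X * fps_exp (?c * ?x a b) * F (u * v)))"
      unfolding D_def F_def gen_bernoulli_fps_scale[OF \<open>d > 0\<close>] fps_const_mult[symmetric]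
      by (simp only: mult_ac)
    then show ?thesis
      unfolding c arg fps_exp_add_mult by (simp only: mult_ac mult_1_left)
  qed
  have "bernoulli_sum_fps d \<chi> y u v w * D (u * v) =
      (\<Sum>a<u * d. \<Sum>b<v * d. fps_const (inverse ?c) * (fps_const (\<chi> (int a) * \<chi> (int b)) *
        ((gen_bernoulli_fps d \<chi> (?x a b) oo (fps_const ?c * fps_X)) * D (u * v))))"
    unfolding bernoulli_sum_fps_def sum_distrib_left sum_distrib_right by (simp only: mult.assoc)
  also have "\<dots> = ?K * (char_exp_sum (u * d) \<chi> (v * w) * char_exp_sum (v * d) \<chi> (w * u))"
    unfolding summand char_exp_sum_def sum_product by (simp only: sum_distrib_left)
  finally have left: "bernoulli_sum_fps d \<chi> y u v w * D (u * v) =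
      ?K * (char_exp_sum (u * d) \<chi> (v * w) * char_exp_sum (v * d) \<chi> (w * u))" .
  have "bernoulli_sum_fps d \<chi> y u v w * (D (u * v) * D (v * w) * D (w * u)) =
      (bernoulli_sum_fps d \<chi> y u v w * D (u * v)) * (D (v * w) * D (w * u))"
    by (simp only: mult.assoc)
  also have "\<dots> =
      ?K * ((char_exp_sum (u * d) \<chi> (v * w) * D (v * w)) *
        (char_exp_sum (v * d) \<chi> (w * u) * D (w * u)))"
    unfolding left by (simp only: mult_ac)
  \<comment> \<open>Since (vw)u = (wu)v = uvw, both block sums produce the same numerator, whence
    the square.\<close>
  also have "char_exp_sum (u * d) \<chi> (v * w) * D (v * w) = F (v * w) * D (u * v * w)"
    unfolding D_def F_def char_exp_sum_periodic[of \<chi>, OF per] by (simp only: mult_ac)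
  also have "char_exp_sum (v * d) \<chi> (w * u) * D (w * u) = F (w * u) * D (u * v * w)"
    unfolding D_def F_def char_exp_sum_periodic[of \<chi>, OF per] by (simp only: mult_ac)
  finally show ?thesis
    by (simp only: power2_eq_square mult_ac)
qed

text \<open>The closed form is unchanged by the cyclic shift, and the common denominator is nonzero,
  hence cancellable in the integral domain of power series.\<close>

lemma bernoulli_sum_fps_rotate:
  fixes y :: "'k::field_char_0"
  assumes "d > 0" "u > 0" "v > 0" "w > 0"
    and per: "\<And>a. \<chi> (a + int d) = \<chi> a"
  shows "bernoulli_sum_fps d \<chi> y u v w = bernoulli_sum_fps d \<chi> y v w u"
proof -
  define D where "D c = fps_exp (of_nat (c * d) :: 'k) - 1" for c
  have "D c \<noteq> 0" if "c > 0" for c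
    unfolding D_def using that assms by (intro fps_exp_minus_one_nonzero) simp
  then have "D (u * v) * D (v * w) * D (w * u) \<noteq> 0"
    using assms by simp
  moreover have "bernoulli_sum_fps d \<chi> y u v w * (D (u * v) * D (v * w) * D (w * u)) =
      bernoulli_sum_fps d \<chi> y v w u * (D (u * v) * D (v * w) * D (w * u))"
    using bernoulli_sum_fps_mult[of d u v \<chi> y w] bernoulli_sum_fps_mult[of d v w \<chi> y u] assms
    unfolding D_def by (simp only: mult_ac)
  ultimately show ?thesis
    by simp
qed

text \<open>The powers of a value are again values of \<open>\<chi>\<close>, of which there are at
  most \<open>d\<close>; so two powers agree and the value is a root of X^i - X^j. This also covers
  the value 0.\<close>

lemma dirichlet_character_algebraic:
  assumes "dirichlet_character d \<chi>"
  shows "algebraic (\<chi> (int a))"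
proof -
  have d: "d > 0" and mult: "\<And>a b. \<chi> (a * b) = \<chi> a * \<chi> b"
    and per: "\<And>a. \<chi> (a + int d) = \<chi> a" and nz: "\<And>a. \<chi> a \<noteq> 0 \<longleftrightarrow> coprime a (int d)"
    using assms by (auto simp: dirichlet_character_def)
  have one: "\<chi> 1 = 1"
    using mult[of 1 1] nz[of 1] by simp
  have pow: "\<chi> (int a) ^ k = \<chi> (int (a ^ k))" for k
    by (induction k) (simp_all add: mult one)
  have shift: "\<chi> (int (m + k * d)) = \<chi> (int m)" for m k
  proof (induction k)
    case (Suc k)
    then show ?case using per[of "int (m + k * d)"] by (simp add: algebra_simps)
  qed simp
  have "\<chi> (int m) \<in> (\<lambda>r. \<chi> (int r)) ` {..<d}" for m
    using shift[of "m mod d" "m div d"] d by (intro image_eqI[of _ _ "m mod d"]) simp_all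
  then have "range (\<lambda>k. \<chi> (int a) ^ k) \<subseteq> (\<lambda>r. \<chi> (int r)) ` {..<d}"
    unfolding pow by blast
  then have "finite (range (\<lambda>k. \<chi> (int a) ^ k))"
    by (rule finite_subset) simp
  then have "\<not> inj (\<lambda>k. \<chi> (int a) ^ k)"
    using range_inj_infinite by blast
  then obtain i j :: nat where ij: "i \<noteq> j" "\<chi> (int a) ^ i = \<chi> (int a) ^ j"
    by (auto simp: inj_def)
  define q where "q = monom (1 :: complex) i - monom 1 j"
  have "coeff q i = 1"
    using ij by (simp add: q_def)
  then have "q \<noteq> 0" by force
  moreover have "poly q (\<chi> (int a)) = 0" "\<forall>k. coeff q k \<in> \<int>"
    using ij by (auto simp: q_def poly_monom coeff_diff)
  ultimately show ?thesis
    unfolding algebraic_def by blast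
qed

theorem theorem6:
  fixes p d n w1 w2 w3 :: nat
    and absv :: "'k::field_char_0 \<Rightarrow> real"
    and \<iota> :: "complex \<Rightarrow> 'k"
    and \<chi> :: "int \<Rightarrow> complex"
    and y1 :: 'k
  assumes "padic_complex_numbers p absv"
    and "algebraic_embedding \<iota>"
    and "d > 0"
    and "primitive_dirichlet_character d \<chi>"
    and "w1 > 0" and "w2 > 0" and "w3 > 0"
    and "y1 \<in> Zp_of absv"
  shows
    "(of_nat (w1 * w2) :: 'k) powi (int n - 1) *
       (\<Sum>a<w1 * d. \<Sum>b<w2 * d. \<iota> (\<chi> (int a * int b)) *
          gen_bernpoly d (\<lambda>c. \<iota> (\<chi> c)) n
            (of_nat w3 * y1 + of_nat w3 / of_nat w1 * of_nat a
                             + of_nat w3 / of_nat w2 * of_nat b))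
     =
     (of_nat (w2 * w3) :: 'k) powi (int n - 1) *
       (\<Sum>a<w2 * d. \<Sum>b<w3 * d. \<iota> (\<chi> (int a * int b)) *
          gen_bernpoly d (\<lambda>c. \<iota> (\<chi> c)) n
            (of_nat w1 * y1 + of_nat w1 / of_nat w2 * of_nat a
                             + of_nat w1 / of_nat w3 * of_nat b))
     \<and>
     (of_nat (w2 * w3) :: 'k) powi (int n - 1) *
       (\<Sum>a<w2 * d. \<Sum>b<w3 * d. \<iota> (\<chi> (int a * int b)) *
          gen_bernpoly d (\<lambda>c. \<iota> (\<chi> c)) n
            (of_nat w1 * y1 + of_nat w1 / of_nat w2 * of_nat a
                             + of_nat w1 / of_nat w3 * of_nat b))
     =
     (of_nat (w3 * w1) :: 'k) powi (int n - 1) *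
       (\<Sum>a<w3 * d. \<Sum>b<w1 * d. \<iota> (\<chi> (int a * int b)) *
          gen_bernpoly d (\<lambda>c. \<iota> (\<chi> c)) n
            (of_nat w2 * y1 + of_nat w2 / of_nat w3 * of_nat a
                             + of_nat w2 / of_nat w1 * of_nat b))"
proof -
  let ?\<psi> = "\<lambda>c. \<iota> (\<chi> c)"
  have \<chi>: "dirichlet_character d \<chi>"
    using assms(4) by (simp add: primitive_dirichlet_character_def)
  then have per: "?\<psi> (a + int d) = ?\<psi> a" for a
    by (simp add: dirichlet_character_def)
  \<comment> \<open>\<open>\<iota>\<close> is multiplicative only on algebraic numbers, so
    algebraicity of the character values enters here.\<close>
  have mult: "\<iota> (\<chi> (int a * int b)) = ?\<psi> (int a) * ?\<psi> (int b)" for a b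
    using \<chi> assms(2) dirichlet_character_algebraic[OF \<chi>]
    by (simp add: dirichlet_character_def algebraic_embedding_def)
  \<comment> \<open>Each equation is one cyclic shift, from (w1, w2, w3) to (w2, w3, w1) and on to
    (w3, w1, w2), read off at the coefficient of t^n.\<close>
  show ?thesis
    unfolding mult
      bernoulli_sum_fps_nth[OF assms(5,6), symmetric, where \<chi> = ?\<psi>]
      bernoulli_sum_fps_nth[OF assms(6,7), symmetric, where \<chi> = ?\<psi>]
      bernoulli_sum_fps_nth[OF assms(7,5), symmetric, where \<chi> = ?\<psi>]
    using bernoulli_sum_fps_rotate[OF assms(3,5,6,7), of ?\<psi> y1, OF per]
      bernoulli_sum_fps_rotate[OF assms(3,6,7,5), of ?\<psi> y1, OF per]
    by simp
qed

end
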